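(* Let $(X,\mathbf{B},\mu)$ be a measure space with a non-trivial $\sigma$-finite measure $\mu$ (possibly $\mu(X)=\infty$). Let $1\le a_1<b_1\le\infty$ and $1\le a_2<b_2\le\infty$ with $b_1<a_2$, and let $\psi\in\Psi(a_1,b_1)$ and $\nu\in\Psi(a_2,b_2)$. Then the double ratio between the Grand Lebesgue spaces $G\psi$ and $G\nu$ equals one: $$ R(G\psi,G\nu)=\sup_{0\ne f\in G\psi\cap G\nu}\ \sup_{A\in\mathbf{B}:\ 0<\mu(A)<\infty}\left[\frac{\|f\|_{\psi,A}}{\phi(G\psi,\mu(A))}:\frac{\|f\|_{\nu,A}}{\phi(G\nu,\mu(A))}\right]=1 . $$
   Context: Here "non-trivial" means $\mu\neq 0$. Functions are measurable $f:X\to\mathbb{R}$, identified when equal $\mu$-almost everywhere. For $1\le p<\infty$ and $A\in\mathbf{B}$ put $|f|_{p,A}=\left(\int_A|f|^p\,d\mu\right)^{1/p}$ and $|f|_p=|f|_{p,X}$. For $1\le a<b\le\infty$, $\Psi(a,b)$ denotes the set of functions $\psi$ that are continuous, positive and finite on the open interval $(a,b)$, with $\inf_{p\in(a,b)}\psi(p)>0$, and with $\psi(p)=\infty$ for $p\notin(a,b)$. For $\psi\in\Psi(a,b)$, the Grand Lebesgue space $G\psi$ consists of all measurable $f:X\to\mathbb{R}$ with finite norm $$\|f\|G(\psi)=\sup_{p\in(a,b)}\frac{|f|_p}{\psi(p)}.$$ The localized norm, for $A\in\mathbf{B}$ with $0<\mu(A)<\infty$, is $$\|f\|_{\psi,A}=\sup_{p\in(a,b)}\frac{|f|_{p,A}}{\psi(p)}.$$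 The fundamental function of $G\psi$ is, for $\delta\in(0,\infty)$, $$\phi(G\psi,\delta)=\sup_{p\in(a,b)}\frac{\delta^{1/p}}{\psi(p)}.$$ The notation $[x:y]$ means the quotient $x/y$. In the double supremum, only pairs $(f,A)$ for which $f$ is not $\mu$-a.e. zero on $A$ are considered, so that the quotient is not of the form $0/0$. *)

theory Defs
  imports "HOL-Analysis.Analysis"
begin

text \<open>
  Norms, weights and quotients take values in \<^typ>\<open>ennreal\<close>, so that infinite norms are
  represented as such. The endpoints of the interval of exponents are extended reals (the right
  one may be infinite); the exponents themselves are real numbers.
\<close>

text \<open>The power \<open>x\<^sup>r\<close> of an extended nonnegative real, for \<open>r > 0\<close> only.\<close>

definition ennreal_powr :: "ennreal \<Rightarrow> real \<Rightarrow> ennreal" where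
  "ennreal_powr x r = (if x = \<infinity> then \<infinity> else ennreal (enn2real x powr r))"

definition Lp_norm_on :: "'a measure \<Rightarrow> real \<Rightarrow> 'a set \<Rightarrow> ('a \<Rightarrow> real) \<Rightarrow> ennreal" where
  "Lp_norm_on M p A f =
     ennreal_powr (\<integral>\<^sup>+ x\<in>A. ennreal (\<bar>f x\<bar> powr p) \<partial>M) (1 / p)"

definition Lp_norm :: "'a measure \<Rightarrow> real \<Rightarrow> ('a \<Rightarrow> real) \<Rightarrow> ennreal" where
  "Lp_norm M p f = Lp_norm_on M p (space M) f"

definition Psi :: "ereal \<Rightarrow> ereal \<Rightarrow> (real \<Rightarrow> ennreal) set" where
  "Psi a b = {\<psi>. continuous_on (einterval a b) \<psi> \<and>
                  (\<forall>p\<in>einterval a b. 0 < \<psi> p \<and> \<psi> p < \<infinity>) \<and>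
                  (INF p\<in>einterval a b. \<psi> p) > 0 \<and>
                  (\<forall>p. p \<notin> einterval a b \<longrightarrow> \<psi> p = \<infinity>)}"

definition gls_norm ::
  "'a measure \<Rightarrow> ereal \<Rightarrow> ereal \<Rightarrow> (real \<Rightarrow> ennreal) \<Rightarrow> ('a \<Rightarrow> real) \<Rightarrow> ennreal" where
  "gls_norm M a b \<psi> f = (SUP p\<in>einterval a b. Lp_norm M p f / \<psi> p)"

text \<open>The Grand Lebesgue space, as a set of functions rather than of a.e.-equivalence classes.\<close>

definition GLS ::
  "'a measure \<Rightarrow> ereal \<Rightarrow> ereal \<Rightarrow> (real \<Rightarrow> ennreal) \<Rightarrow> ('a \<Rightarrow> real) set" where
  "GLS M a b \<psi> = {f \<in> borel_measurable M. gls_norm M a b \<psi> f < \<infinity>}"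

definition gls_norm_on ::
  "'a measure \<Rightarrow> ereal \<Rightarrow> ereal \<Rightarrow> (real \<Rightarrow> ennreal) \<Rightarrow> 'a set \<Rightarrow> ('a \<Rightarrow> real) \<Rightarrow> ennreal" where
  "gls_norm_on M a b \<psi> A f = (SUP p\<in>einterval a b. Lp_norm_on M p A f / \<psi> p)"

definition gls_fundamental :: "ereal \<Rightarrow> ereal \<Rightarrow> (real \<Rightarrow> ennreal) \<Rightarrow> real \<Rightarrow> ennreal" where
  "gls_fundamental a b \<psi> \<delta> = (SUP p\<in>einterval a b. ennreal (\<delta> powr (1 / p)) / \<psi> p)"

text \<open>
  Since functions are identified when they agree almost everywhere, \<open>f \<noteq> 0\<close> means that \<open>f\<close> is
  not a.e. zero. The sets \<open>A\<close> on which \<open>f\<close> is a.e. zero are left out, as the quotient would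
  be \<open>0 / 0\<close> there.
\<close>

definition double_ratio ::
  "'a measure \<Rightarrow> ereal \<Rightarrow> ereal \<Rightarrow> (real \<Rightarrow> ennreal) \<Rightarrow>
     ereal \<Rightarrow> ereal \<Rightarrow> (real \<Rightarrow> ennreal) \<Rightarrow> ennreal" where
  "double_ratio M a\<^sub>1 b\<^sub>1 \<psi> a\<^sub>2 b\<^sub>2 \<nu> =
     (SUP f\<in>{f \<in> GLS M a\<^sub>1 b\<^sub>1 \<psi> \<inter> GLS M a\<^sub>2 b\<^sub>2 \<nu>. \<not> (AE x in M. f x = 0)}.
        SUP A\<in>{A \<in> sets M. 0 < emeasure M A \<and> emeasure M A < \<infinity> \<and> \<not> (AE x\<in>A in M. f x = 0)}.
          (gls_norm_on M a\<^sub>1 b\<^sub>1 \<psi> A f / gls_fundamental a\<^sub>1 b\<^sub>1 \<psi> (measure M A)) /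
          (gls_norm_on M a\<^sub>2 b\<^sub>2 \<nu> A f / gls_fundamental a\<^sub>2 b\<^sub>2 \<nu> (measure M A)))"

end

theory Submission
  imports Defs
begin

text \<open>
  Over a set \<open>A\<close> of finite positive measure, the power mean
  \<open>M\<^sub>p = \<mu>(A)\<^bsup>-1/p\<^esup> |f|\<^bsub>p,A\<^esub>\<close> is nondecreasing in \<open>p\<close>. Comparing with
  \<open>K = M\<^sub>r\<close> for \<open>r = b\<^sub>1\<close> gives \<open>|f|\<^bsub>p,A\<^esub> \<le> K \<mu>(A)\<^bsup>1/p\<^esup>\<close> for \<open>p < b\<^sub>1\<close> and the reverse
  inequality for \<open>p > a\<^sub>2\<close>. Hence the numerator of the double ratio is at most \<open>K\<close> and its
  denominator is at least \<open>K\<close>. Both are equal to \<open>1\<close> when \<open>f\<close> is the indicator function of \<open>A\<close>.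
\<close>

lemma ennreal_inverse_antimono: "x \<le> y \<Longrightarrow> inverse y \<le> inverse (x :: ennreal)"
  unfolding less_eq_ennreal.rep_eq inverse_ennreal.rep_eq
  by (rule ereal_inverse_antimono) simp_all

text \<open>The case \<open>y = 0\<close> is included because \<open>0 / 0 = 0\<close>, and \<open>y = \<infinity>\<close> because \<open>\<infinity> / \<infinity> = 0\<close>.\<close>

lemma ennreal_divide_le_1:
  assumes "x \<le> (y :: ennreal)"
  shows "x / y \<le> 1"
proof -
  have "x / y \<le> y / y"
    using assms by (rule divide_right_mono_ennreal)
  also have "y / y \<le> 1"
    by (cases "y = 0 \<or> y = \<infinity>") (auto simp: ennreal_divide_self less_top)
  finally show ?thesis .
qed

lemma ennreal_powr_ennreal: "0 \<le> x \<Longrightarrow> ennreal_powr (ennreal x) r = ennreal (x powr r)"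
  by (simp add: ennreal_powr_def)

lemma ennreal_powr_mono: "x \<le> y \<Longrightarrow> 0 \<le> r \<Longrightarrow> ennreal_powr x r \<le> ennreal_powr y r"
  by (cases x; cases y) (auto simp: ennreal_powr_def top_unique intro!: powr_mono2)

text \<open>Young's inequality for \<open>(u / t) powr q\<close> and \<open>1\<close> with weights
  \<open>p / q\<close> and \<open>1 - p / q\<close>. In the variable \<open>s = u powr q\<close>,
  the right-hand side is the tangent at \<open>s = t powr q\<close> to the concave map sending
  \<open>s\<close> to \<open>s powr (p / q)\<close>. Being affine in \<open>u powr q\<close>, the
  bound can be integrated term by term.\<close>

lemma powr_le_affine:
  fixes u t p q :: real
  assumes "0 < p" "p < q" "0 < t" "0 \<le> u"
  shows "u powr p \<le> t powr p * (p / q / t powr q * u powr q + (1 - p / q))"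
proof (cases "u = 0")
  case True
  then show ?thesis
    using assms by simp
next
  case False
  have "((u / t) powr q) powr (p / q) * 1 powr (1 - p / q)
      \<le> p / q * (u / t) powr q + (1 - p / q) * 1"
    using assms False by (intro Youngs_inequality_0) auto
  then have "(u / t) powr p \<le> p / q * (u / t) powr q + (1 - p / q)"
    using assms by (simp add: powr_powr)
  then have "t powr p * (u / t) powr p \<le> t powr p * (p / q * (u / t) powr q + (1 - p / q))"
    by (intro mult_left_mono) auto
  then show ?thesis
    using assms by (simp add: powr_divide)
qed

text \<open>Integrating \<open>powr_le_affine\<close> with \<open>u = \<bar>f x\<bar>\<close> over
  \<open>A\<close> bounds the integral for \<open>p\<close> by an affine expression in the integral
  for \<open>q\<close>. The tangent point \<open>t\<close> has to be positive and finite, so the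
  values \<open>\<infinity>\<close> and \<open>0\<close> of the latter are treated apart.\<close>

lemma power_mean_mono:
  assumes f[measurable]: "f \<in> borel_measurable M" and A[measurable]: "A \<in> sets M"
    and pos: "0 < emeasure M A" and fin: "emeasure M A < \<infinity>"
    and p: "0 < p" "p < q"
  shows "Lp_norm_on M p A f / ennreal (measure M A powr (1 / p))
       \<le> Lp_norm_on M q A f / ennreal (measure M A powr (1 / q))"
proof -
  define m where "m = measure M A"
  have mA: "emeasure M A = ennreal m"
    using fin by (simp add: m_def emeasure_eq_ennreal_measure)
  then have m: "0 < m"
    using pos by simp
  define I where "I r = (\<integral>\<^sup>+ x\<in>A. ennreal (\<bar>f x\<bar> powr r) \<partial>M)" for r
  have Lp: "Lp_norm_on M r A f = ennreal_powr (I r) (1 / r)" for r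
    by (simp add: Lp_norm_on_def I_def)
  consider "I q = \<infinity>" | "I q = 0" | J where "I q = ennreal J" "0 < J"
    by (cases "I q") (auto simp: le_less)
  then show ?thesis
  proof cases
    case 1
    then show ?thesis
      by (simp add: Lp ennreal_powr_def ennreal_top_divide)
  next
    case 2
    \<comment> \<open>A zero integral means that \<open>f\<close> vanishes a.e. on \<open>A\<close>,
      a condition that does not depend on the exponent.\<close>
    then have "AE x in M. ennreal (\<bar>f x\<bar> powr q) * indicator A x = 0"
      unfolding I_def by (subst (asm) nn_integral_0_iff_AE) auto
    then have "AE x in M. ennreal (\<bar>f x\<bar> powr p) * indicator A x = 0"
      by (rule AE_mp) (auto intro!: AE_I2)
    then have "I p = 0"
      unfolding I_def by (subst nn_integral_0_iff_AE) auto
    then show ?thesis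
      by (simp add: Lp ennreal_powr_def)
  next
    case 3
    \<comment> \<open>The tangent point is the \<open>q\<close>-th power mean of \<open>f\<close>
      over \<open>A\<close>, that is, the right-hand side of the goal.\<close>
    define t where "t = (J / m) powr (1 / q)"
    have t: "0 < t"
      using 3 m by (simp add: t_def)
    have tq: "t powr q = J / m"
      using 3 m p by (simp add: t_def powr_powr)
    define c where "c = t powr p * (p / q / t powr q)"
    define d where "d = t powr p * (1 - p / q)"
    have c: "0 \<le> c" and d: "0 \<le> d"
      using p by (auto simp: c_def d_def)
    have "I p \<le> (\<integral>\<^sup>+ x. ennreal c * (ennreal (\<bar>f x\<bar> powr q) * indicator A x)
        + ennreal d * indicator A x \<partial>M)"
      unfolding I_def
    proof (rule nn_integral_mono)
      fix x
      have "\<bar>f x\<bar> powr p \<le> c * \<bar>f x\<bar> powr q + d"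
        using powr_le_affine[OF p t, of "\<bar>f x\<bar>"] by (simp add: c_def d_def algebra_simps)
      then show "ennreal (\<bar>f x\<bar> powr p) * indicator A x
          \<le> ennreal c * (ennreal (\<bar>f x\<bar> powr q) * indicator A x) + ennreal d * indicator A x"
        using c d by (auto simp: indicator_def ennreal_plus[symmetric] ennreal_mult[symmetric]
            simp del: ennreal_plus intro!: ennreal_leI)
    qed
    also have "\<dots> = ennreal c * I q + ennreal d * emeasure M A"
      unfolding I_def by (subst nn_integral_add) (auto simp: nn_integral_cmult)
    also have "\<dots> = ennreal (c * J + d * m)"
      using c d 3 m mA by (simp add: ennreal_mult)
    \<comment> \<open>Since \<open>t powr q = J / m\<close>, the two terms contribute the fractions
      \<open>p / q\<close> and \<open>1 - p / q\<close> of \<open>t powr p * m\<close>.\<close>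
    also have "c * J + d * m = t powr p * m"
      using 3 m p by (simp add: c_def d_def tq field_simps)
    finally have "ennreal_powr (I p) (1 / p) \<le> ennreal_powr (ennreal (t powr p * m)) (1 / p)"
      using p by (intro ennreal_powr_mono) auto
    also have "\<dots> = ennreal (t * m powr (1 / p))"
      using p t m by (simp add: ennreal_powr_ennreal powr_mult powr_powr)
    finally have "ennreal_powr (I p) (1 / p) / ennreal (m powr (1 / p))
        \<le> ennreal (t * m powr (1 / p)) / ennreal (m powr (1 / p))"
      by (rule divide_right_mono_ennreal)
    also have "\<dots> = ennreal t"
      using t m by (simp add: divide_ennreal)
    also have "\<dots> = ennreal_powr (I q) (1 / q) / ennreal (m powr (1 / q))"
      using 3 m by (simp add: ennreal_powr_ennreal divide_ennreal t_def powr_divide)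
    finally show ?thesis
      by (simp add: Lp m_def)
  qed
qed

lemma einterval_gt_1:
  assumes "1 \<le> a" "p \<in> einterval a b"
  shows "1 < p"
proof -
  have "1 < ereal p"
    using assms le_less_trans[of 1 a "ereal p"] by (simp add: einterval_def)
  then show ?thesis
    by (simp add: one_ereal_def)
qed

lemma gls_fundamental_nonzero:
  assumes "a < b" and "\<psi> \<in> Psi a b" and "0 < \<delta>"
  shows "gls_fundamental a b \<psi> \<delta> \<noteq> 0"
proof -
  obtain p where p: "p \<in> einterval a b"
    using einterval_nonempty[OF assms(1)] by auto
  then have "\<psi> p < \<infinity>"
    using assms(2) by (auto simp: Psi_def)
  then have "0 < ennreal (\<delta> powr (1 / p)) / \<psi> p"
    using assms(3) by (simp add: ennreal_zero_less_divide)
  also have "\<dots> \<le> gls_fundamental a b \<psi> \<delta>"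
    unfolding gls_fundamental_def using p by (rule SUP_upper)
  finally show ?thesis
    by simp
qed

text \<open>All exponents satisfy \<open>0 < 1 / p < 1\<close>, so the numerators are at most
  \<open>max 1 \<delta>\<close>, while the weight stays above its positive infimum.\<close>

lemma gls_fundamental_finite:
  assumes a: "1 \<le> a" and \<psi>: "\<psi> \<in> Psi a b" and "0 < \<delta>"
  shows "gls_fundamental a b \<psi> \<delta> < \<infinity>"
proof -
  define c where "c = (INF p\<in>einterval a b. \<psi> p)"
  have c: "0 < c"
    using \<psi> by (simp add: Psi_def c_def)
  have "ennreal (\<delta> powr (1 / p)) / \<psi> p \<le> ennreal (max 1 \<delta>) / c" if p: "p \<in> einterval a b" for p
  proof -
    have "1 < p"
      using a p by (rule einterval_gt_1)
    then have "\<delta> powr (1 / p) \<le> max 1 \<delta> powr (1 / p)"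
      using assms(3) by (intro powr_mono2) auto
    also have "\<dots> \<le> max 1 \<delta> powr 1"
      using \<open>1 < p\<close> by (intro powr_mono) auto
    finally have "\<delta> powr (1 / p) \<le> max 1 \<delta>"
      by simp
    moreover have "c \<le> \<psi> p"
      unfolding c_def using p by (rule INF_lower)
    ultimately show ?thesis
      unfolding divide_ennreal_def by (intro mult_mono ennreal_leI ennreal_inverse_antimono) auto
  qed
  then have "gls_fundamental a b \<psi> \<delta> \<le> ennreal (max 1 \<delta>) / c"
    unfolding gls_fundamental_def by (rule SUP_least)
  also have "\<dots> < \<infinity>"
    using c by (auto simp: ennreal_divide_eq_top_iff less_top[symmetric])
  finally show ?thesis .
qed

text \<open>For every \<open>p\<close> the integral is the measure of \<open>A\<close>. The set
  \<open>B\<close> will be \<open>A\<close> for the localized norm and \<open>space M\<close> for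
  membership in the Grand Lebesgue space.\<close>

lemma gls_norm_on_indicator:
  assumes A: "A \<in> sets M" "emeasure M A < \<infinity>" and "A \<subseteq> B"
  shows "gls_norm_on M a b \<psi> B (indicator A) = gls_fundamental a b \<psi> (measure M A)"
  unfolding gls_norm_on_def gls_fundamental_def
proof (intro SUP_cong refl)
  fix p
  have "(\<integral>\<^sup>+ x\<in>B. ennreal (\<bar>indicator A x\<bar> powr p) \<partial>M) = (\<integral>\<^sup>+ x. indicator A x \<partial>M)"
    using \<open>A \<subseteq> B\<close> by (intro nn_integral_cong) (auto simp: indicator_def)
  also have "\<dots> = ennreal (measure M A)"
    using A by (simp add: emeasure_eq_ennreal_measure)
  finally show "Lp_norm_on M p B (indicator A) / \<psi> p
      = ennreal (measure M A powr (1 / p)) / \<psi> p"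
    by (simp add: Lp_norm_on_def ennreal_powr_ennreal)
qed

lemma gls_norm_eq_gls_norm_on: "gls_norm M a b \<psi> f = gls_norm_on M a b \<psi> (space M) f"
  by (simp add: gls_norm_def gls_norm_on_def Lp_norm_def)

lemma indicator_in_GLS:
  assumes "A \<in> sets M" "0 < measure M A" "emeasure M A < \<infinity>" "1 \<le> a" "\<psi> \<in> Psi a b"
  shows "indicator A \<in> GLS M a b \<psi>"
  using assms sets.sets_into_space[of A M] gls_fundamental_finite[of a \<psi> b "measure M A"]
  by (simp add: GLS_def gls_norm_eq_gls_norm_on gls_norm_on_indicator)

lemma gls_quotient_le_1:
  assumes f: "f \<in> borel_measurable M" and A: "A \<in> sets M" "0 < emeasure M A" "emeasure M A < \<infinity>"
    and a1: "1 \<le> a\<^sub>1" and ab1: "a\<^sub>1 < b\<^sub>1"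
    and a2: "1 \<le> a\<^sub>2" and ab2: "a\<^sub>2 < b\<^sub>2" and sep: "b\<^sub>1 < a\<^sub>2"
    and \<psi>: "\<psi> \<in> Psi a\<^sub>1 b\<^sub>1" and \<nu>: "\<nu> \<in> Psi a\<^sub>2 b\<^sub>2"
  shows "(gls_norm_on M a\<^sub>1 b\<^sub>1 \<psi> A f / gls_fundamental a\<^sub>1 b\<^sub>1 \<psi> (measure M A)) /
         (gls_norm_on M a\<^sub>2 b\<^sub>2 \<nu> A f / gls_fundamental a\<^sub>2 b\<^sub>2 \<nu> (measure M A)) \<le> 1"
    (is "(?x / ?\<phi>) / (?y / ?\<chi>) \<le> 1")
proof -
  define m where "m = measure M A"
  have m: "0 < m"
    using A by (simp add: m_def measure_def enn2real_positive_iff)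
  \<comment> \<open>The endpoint \<open>b\<^sub>1\<close> lies strictly between \<open>1\<close> and
    \<open>a\<^sub>2\<close>, hence is real and can serve as the exponent that separates the two
    intervals.\<close>
  obtain r where r: "b\<^sub>1 = ereal r"
    using a1 ab1 sep by (cases b\<^sub>1) auto
  have "ereal 1 < ereal r"
    using le_less_trans[OF a1 ab1] by (simp add: r one_ereal_def)
  then have r1: "1 < r"
    by simp
  \<comment> \<open>The value \<open>mean r\<close> is the constant \<open>K\<close> of the outline;
    it may be \<open>0\<close> or \<open>\<infinity>\<close>.\<close>
  define mean where "mean p = Lp_norm_on M p A f / ennreal (m powr (1 / p))" for p
  have mean: "Lp_norm_on M p A f = mean p * ennreal (m powr (1 / p))" for p
    using m by (simp add: mean_def ennreal_divide_times ennreal_mult_divide_eq)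
  have "?x \<le> mean r * ?\<phi>"
    unfolding gls_norm_on_def
  proof (rule SUP_least)
    fix p assume p: "p \<in> einterval a\<^sub>1 b\<^sub>1"
    have "1 < p"
      using a1 p by (rule einterval_gt_1)
    then have "mean p \<le> mean r"
      unfolding mean_def m_def using p r f A
      by (intro power_mean_mono) (auto simp: einterval_def)
    then have "Lp_norm_on M p A f / \<psi> p \<le> mean r * (ennreal (m powr (1 / p)) / \<psi> p)"
      unfolding mean ennreal_times_divide by (intro divide_right_mono_ennreal mult_right_mono) auto
    also have "\<dots> \<le> mean r * ?\<phi>"
      unfolding gls_fundamental_def m_def[symmetric] using p
      by (intro mult_left_mono SUP_upper) auto
    finally show "Lp_norm_on M p A f / \<psi> p \<le> mean r * ?\<phi>" .
  qed
  moreover have "mean r * ?\<chi> \<le> ?y"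
    unfolding gls_fundamental_def SUP_mult_left_ennreal m_def[symmetric]
  proof (rule SUP_least)
    fix q assume q: "q \<in> einterval a\<^sub>2 b\<^sub>2"
    have "ereal r < ereal q"
      using less_trans[OF sep, of "ereal q"] q r by (simp add: einterval_def)
    then have "mean r \<le> mean q"
      unfolding mean_def m_def using r1 f A by (intro power_mean_mono) auto
    then have "mean r * (ennreal (m powr (1 / q)) / \<nu> q) \<le> Lp_norm_on M q A f / \<nu> q"
      unfolding mean ennreal_times_divide by (intro divide_right_mono_ennreal mult_right_mono) auto
    also have "\<dots> \<le> ?y"
      unfolding gls_norm_on_def using q by (rule SUP_upper)
    finally show "mean r * (ennreal (m powr (1 / q)) / \<nu> q) \<le> ?y" .
  qed
  \<comment> \<open>Factors that are neither \<open>0\<close> nor \<open>\<infinity>\<close> cancel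
    in \<open>ennreal\<close> whatever the value of \<open>mean r\<close>.\<close>
  moreover have "?\<phi> \<noteq> 0" "?\<phi> < \<infinity>" "?\<chi> \<noteq> 0" "?\<chi> < \<infinity>"
    using gls_fundamental_nonzero[OF ab1 \<psi> m] gls_fundamental_finite[OF a1 \<psi> m]
      gls_fundamental_nonzero[OF ab2 \<nu> m] gls_fundamental_finite[OF a2 \<nu> m]
    by (simp_all add: m_def)
  ultimately have "?x / ?\<phi> \<le> mean r" "mean r \<le> ?y / ?\<chi>"
    using divide_right_mono_ennreal[of ?x "mean r * ?\<phi>" ?\<phi>]
      divide_right_mono_ennreal[of "mean r * ?\<chi>" ?y ?\<chi>]
    by (auto simp: ennreal_mult_divide_eq)
  then have "?x / ?\<phi> \<le> ?y / ?\<chi>"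
    by (rule order_trans)
  then show ?thesis
    by (rule ennreal_divide_le_1)
qed

theorem theorem2p1:
  fixes M :: "'a measure"
    and a\<^sub>1 b\<^sub>1 a\<^sub>2 b\<^sub>2 :: ereal
    and \<psi> \<nu> :: "real \<Rightarrow> ennreal"
  assumes "sigma_finite_measure M" and "emeasure M (space M) \<noteq> 0"
    and "1 \<le> a\<^sub>1" and "a\<^sub>1 < b\<^sub>1" and "b\<^sub>1 \<le> \<infinity>"
    and "1 \<le> a\<^sub>2" and "a\<^sub>2 < b\<^sub>2" and "b\<^sub>2 \<le> \<infinity>"
    and "b\<^sub>1 < a\<^sub>2"
    and "\<psi> \<in> Psi a\<^sub>1 b\<^sub>1" and "\<nu> \<in> Psi a\<^sub>2 b\<^sub>2"
  shows "double_ratio M a\<^sub>1 b\<^sub>1 \<psi> a\<^sub>2 b\<^sub>2 \<nu> = 1"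
proof (rule antisym)
  show "double_ratio M a\<^sub>1 b\<^sub>1 \<psi> a\<^sub>2 b\<^sub>2 \<nu> \<le> 1"
    unfolding double_ratio_def using assms(3-11)
    by (intro SUP_least gls_quotient_le_1) (auto simp: GLS_def)
next
  interpret sigma_finite_measure M by fact
  obtain F :: "nat \<Rightarrow> 'a set" where F: "range F \<subseteq> sets M" "(\<Union>i. F i) = space M"
    "\<And>i. emeasure M (F i) \<noteq> \<infinity>"
    using sigma_finite by metis
  \<comment> \<open>If all members of the countable cover were null, the whole space would be
    null.\<close>
  obtain i where "emeasure M (F i) \<noteq> 0"
    using emeasure_UN_eq_0[of M F] F assms(2) by auto
  then obtain A where A: "A \<in> sets M" "emeasure M A \<noteq> 0" "emeasure M A < \<infinity>"
    using F that[of "F i"] by (auto simp: less_top)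
  then have mA: "0 < measure M A"
    by (simp add: measure_def enn2real_positive_iff zero_less_iff_neq_zero)
  \<comment> \<open>The exceptional set is \<open>A\<close> itself, which is not null.\<close>
  have "\<not> (AE x in M. indicator A x = (0::real))"
    using A AE_iff_measurable[OF A(1), of "\<lambda>x. indicator A x = (0::real)"] sets.sets_into_space[OF A(1)]
    by (auto simp: indicator_eq_0_iff Int_absorb1 Collect_conj_eq)
  \<comment> \<open>The indicator vanishes off \<open>A\<close>, so vanishing a.e. on
    \<open>A\<close> would mean vanishing a.e. everywhere.\<close>
  moreover from this have "\<not> (AE x\<in>A in M. indicator A x = (0::real))"
    by (auto simp: indicator_def elim!: eventually_mono)
  \<comment> \<open>Each localized norm of the indicator equals the matching fundamental function,
    which is nonzero and finite, so both inner quotients are \<open>1\<close>.\<close>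
  moreover have "1 = (gls_norm_on M a\<^sub>1 b\<^sub>1 \<psi> A (indicator A) / gls_fundamental a\<^sub>1 b\<^sub>1 \<psi> (measure M A)) /
      (gls_norm_on M a\<^sub>2 b\<^sub>2 \<nu> A (indicator A) / gls_fundamental a\<^sub>2 b\<^sub>2 \<nu> (measure M A))"
    using A mA assms gls_fundamental_finite[OF assms(3,10) mA]
      gls_fundamental_finite[OF assms(6,11) mA]
    by (simp add: gls_norm_on_indicator gls_fundamental_nonzero ennreal_divide_self)
  ultimately show "1 \<le> double_ratio M a\<^sub>1 b\<^sub>1 \<psi> a\<^sub>2 b\<^sub>2 \<nu>"
    unfolding double_ratio_def using A mA assms
    by (intro SUP_upper2[where i = "indicator A"] SUP_upper2[where i = A])
      (auto simp: indicator_in_GLS zero_less_iff_neq_zero)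
qed

end
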